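(* Let $\mathcal K$ be a Cartesian category. The pseudo double category $\mathbf{Mly}(\mathcal K)$ admits a (tight) terminal object and (tight) pullbacks as soon as $\mathcal K$ admits a terminal object and pullbacks. Likewise, it admits wide pullbacks, or products of all (small) cardinalities and equalizers, as soon as $\mathcal K$ does.
   Context: For $\mathcal K$ a category with finite products, $\mathbf{Mly}(\mathcal K)$ is the following pseudo double category. Objects and tight morphisms are those of $\mathcal K$. A loose morphism $A\nrightarrow B$ is a triple $(E,d,s)$ with $E$ an object (the carrier) and $d:A\times E\to E$, $s:A\times E\to B$ morphisms of $\mathcal K$. A cell from $(E,d,s):A\nrightarrow B$ to $(E',d',s'):X\nrightarrow Y$ with left side $f:A\to X$ and right side $g:B\to Y$ is a morphism $\alpha:E\to E'$ with $\alpha\circ d=d'\circ(f\times\alpha)$ and $g\circ s=s'\circ(f\times\alpha)$. The loose identity $\iota_A:A\nrightarrow A$ has carrier the terminal object $1$ and output map the projection $A\times 1\to A$. Vertical composition of cells is composition in $\mathcal K$. Every tight $f:A\to B$ induces the identity cell $\iota_f:\iota_A\Rightarrow\iota_B$, given by $\mathrm{id}_1$, with both sides $f$. A (tight) terminal object of $\mathbf{Mly}(\mathcal K)$ is an object $\top$ that is terminal in $\mathcal K$ and such that for every loose morphism $p:A\nrightarrow B$ there is a unique cell $p\Rightarrow\iota_\top$ with sides the unique morphisms $A\to\top$, $B\to\top$. More generally, the (tight) limit of a functor $D:J\to\mathcal K$ in $\mathbf{Mly}(\mathcal K)$ is an object $L$ with a cone $(p_j:L\to D_j)_j$ such that: (a)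 it is a limit cone in $\mathcal K$; (b) for every loose morphism $u:U\nrightarrow V$, every pair of cones $(a_j:U\to D_j)$, $(a'_j:V\to D_j)$ over $D$, and every family of cells $\xi_j:u\Rightarrow\iota_{D_j}$ with left side $a_j$ and right side $a'_j$ such that $\iota_{D(k)}\circ\xi_j=\xi_{j'}$ for all $k:j\to j'$ in $J$, there is a unique cell $\xi:u\Rightarrow\iota_L$, with sides the induced morphisms $U\to L$ and $V\to L$, such that $\iota_{p_j}\circ\xi=\xi_j$ for all $j$. Pullbacks, wide pullbacks, products and equalizers are the cases where $J$ is a cospan, a wide cospan, discrete, or a parallel pair. *)

theory Defs
  imports Main
begin

section \<open>Categories, functors and limits\<close>

record ('o, 'a) cat =
  Obj :: "'o set"
  Arr :: "'a set"
  Dom :: "'a \<Rightarrow> 'o"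
  Cod :: "'a \<Rightarrow> 'o"
  Ident :: "'o \<Rightarrow> 'a"
  Comp :: "'a \<Rightarrow> 'a \<Rightarrow> 'a"  (infixr "\<cdot>\<index>" 70)

definition hom :: "('o, 'a, 'z) cat_scheme \<Rightarrow> 'o \<Rightarrow> 'o \<Rightarrow> 'a set" where
  "hom C A B = {f \<in> Arr C. Dom C f = A \<and> Cod C f = B}"

locale category =
  fixes C :: "('o, 'a, 'z) cat_scheme" (structure)
  assumes dom_obj: "f \<in> Arr C \<Longrightarrow> Dom C f \<in> Obj C"
    and cod_obj: "f \<in> Arr C \<Longrightarrow> Cod C f \<in> Obj C"
    and ident_hom: "A \<in> Obj C \<Longrightarrow> Ident C A \<in> hom C A A"
    and comp_hom: "\<lbrakk>f \<in> hom C X Y; g \<in> hom C Y Z\<rbrakk> \<Longrightarrow> g \<cdot> f \<in> hom C X Z"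
    and ident_left: "f \<in> hom C X Y \<Longrightarrow> Ident C Y \<cdot> f = f"
    and ident_right: "f \<in> hom C X Y \<Longrightarrow> f \<cdot> Ident C X = f"
    and comp_assoc: "\<lbrakk>f \<in> hom C W X; g \<in> hom C X Y; h \<in> hom C Y Z\<rbrakk>
      \<Longrightarrow> (h \<cdot> g) \<cdot> f = h \<cdot> (g \<cdot> f)"

definition is_terminal :: "('o, 'a, 'z) cat_scheme \<Rightarrow> 'o \<Rightarrow> bool" where
  "is_terminal C T \<longleftrightarrow> T \<in> Obj C \<and> (\<forall>A\<in>Obj C. \<exists>!f. f \<in> hom C A T)"

definition has_terminal :: "('o, 'a, 'z) cat_scheme \<Rightarrow> bool" where
  "has_terminal C \<longleftrightarrow> (\<exists>T. is_terminal C T)"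

record ('j, 'k, 'o, 'a) diagram =
  obj_map :: "'j \<Rightarrow> 'o"
  arr_map :: "'k \<Rightarrow> 'a"

definition is_functor ::
  "('j, 'k, 'y) cat_scheme \<Rightarrow> ('o, 'a, 'z) cat_scheme \<Rightarrow> ('j, 'k, 'o, 'a) diagram \<Rightarrow> bool" where
  "is_functor J C D \<longleftrightarrow>
     (\<forall>j\<in>Obj J. obj_map D j \<in> Obj C) \<and>
     (\<forall>k\<in>Arr J. arr_map D k \<in> hom C (obj_map D (Dom J k)) (obj_map D (Cod J k))) \<and>
     (\<forall>j\<in>Obj J. arr_map D (Ident J j) = Ident C (obj_map D j)) \<and>
     (\<forall>k\<in>Arr J. \<forall>l\<in>Arr J. Cod J k = Dom J l \<longrightarrow>
        arr_map D (l \<cdot>\<^bsub>J\<^esub> k) = arr_map D l \<cdot>\<^bsub>C\<^esub> arr_map D k)"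

definition is_cone ::
  "('j, 'k, 'y) cat_scheme \<Rightarrow> ('o, 'a, 'z) cat_scheme \<Rightarrow> ('j, 'k, 'o, 'a) diagram
    \<Rightarrow> 'o \<Rightarrow> ('j \<Rightarrow> 'a) \<Rightarrow> bool" where
  "is_cone J C D X q \<longleftrightarrow>
     X \<in> Obj C \<and>
     (\<forall>j\<in>Obj J. q j \<in> hom C X (obj_map D j)) \<and>
     (\<forall>k\<in>Arr J. arr_map D k \<cdot>\<^bsub>C\<^esub> q (Dom J k) = q (Cod J k))"

definition is_induced ::
  "('j, 'k, 'y) cat_scheme \<Rightarrow> ('o, 'a, 'z) cat_scheme \<Rightarrow> 'o \<Rightarrow> ('j \<Rightarrow> 'a)
    \<Rightarrow> 'o \<Rightarrow> ('j \<Rightarrow> 'a) \<Rightarrow> 'a \<Rightarrow> bool" where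
  "is_induced J C L p X q h \<longleftrightarrow> h \<in> hom C X L \<and> (\<forall>j\<in>Obj J. p j \<cdot>\<^bsub>C\<^esub> h = q j)"

definition is_limit ::
  "('j, 'k, 'y) cat_scheme \<Rightarrow> ('o, 'a, 'z) cat_scheme \<Rightarrow> ('j, 'k, 'o, 'a) diagram
    \<Rightarrow> 'o \<Rightarrow> ('j \<Rightarrow> 'a) \<Rightarrow> bool" where
  "is_limit J C D L p \<longleftrightarrow>
     is_cone J C D L p \<and>
     (\<forall>X q. is_cone J C D X q \<longrightarrow> (\<exists>!h. is_induced J C L p X q h))"

definition has_limits :: "('j, 'k, 'y) cat_scheme \<Rightarrow> ('o, 'a, 'z) cat_scheme \<Rightarrow> bool" where
  "has_limits J C \<longleftrightarrow> (\<forall>D. is_functor J C D \<longrightarrow> (\<exists>L p. is_limit J C D L p))"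


section \<open>Diagram shapes\<close>

definition discrete :: "'i set \<Rightarrow> ('i, 'i \<times> 'i) cat" where
  "discrete I =
    \<lparr>Obj = I, Arr = {(i, i) | i. i \<in> I}, Dom = fst, Cod = snd,
     Ident = (\<lambda>i. (i, i)), Comp = (\<lambda>l k. (fst k, snd l))\<rparr>"

text \<open>The vertex of the wide cospan is \<^term>\<open>None\<close>; its feet are indexed by \<open>I\<close>.\<close>

definition wide_cospan :: "'i set \<Rightarrow> ('i option, 'i option \<times> 'i option) cat" where
  "wide_cospan I =
    \<lparr>Obj = insert None (Some ` I),
     Arr = {(x, x) | x. x \<in> insert None (Some ` I)} \<union> {(Some i, None) | i. i \<in> I},
     Dom = fst, Cod = snd,
     Ident = (\<lambda>x. (x, x)), Comp = (\<lambda>l k. (fst k, snd l))\<rparr>"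

definition cospan :: "(bool option, bool option \<times> bool option) cat" where
  "cospan = wide_cospan (UNIV :: bool set)"

datatype pp_obj = PSrc | PTgt
datatype pp_arr = PId pp_obj | PFst | PSnd

definition parallel_pair :: "(pp_obj, pp_arr) cat" where
  "parallel_pair =
    \<lparr>Obj = UNIV, Arr = UNIV,
     Dom = (\<lambda>k. case k of PId x \<Rightarrow> x | _ \<Rightarrow> PSrc),
     Cod = (\<lambda>k. case k of PId x \<Rightarrow> x | _ \<Rightarrow> PTgt),
     Ident = PId,
     Comp = (\<lambda>l k. case k of PId _ \<Rightarrow> l | _ \<Rightarrow> k)\<rparr>"

lemma category_discrete: "category (discrete I)"
  by unfold_locales (auto simp: discrete_def hom_def)

lemma category_wide_cospan: "category (wide_cospan I)"
  by unfold_locales (auto simp: wide_cospan_def hom_def)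

lemma category_cospan: "category cospan"
  unfolding cospan_def by (rule category_wide_cospan)

lemma category_parallel_pair: "category parallel_pair"
  by unfold_locales (auto simp: parallel_pair_def hom_def split: pp_arr.splits)


section \<open>Cartesian categories\<close>

record ('o, 'a) cart_cat = "('o, 'a) cat" +
  One :: 'o
  Prod :: "'o \<Rightarrow> 'o \<Rightarrow> 'o"
  Proj1 :: "'o \<Rightarrow> 'o \<Rightarrow> 'a"
  Proj2 :: "'o \<Rightarrow> 'o \<Rightarrow> 'a"

locale cartesian_category = category K
  for K :: "('o, 'a, 'z) cart_cat_scheme" (structure) +
  assumes one_terminal: "is_terminal K (One K)"
    and prod_obj: "\<lbrakk>A \<in> Obj K; B \<in> Obj K\<rbrakk> \<Longrightarrow> Prod K A B \<in> Obj K"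
    and proj1_hom: "\<lbrakk>A \<in> Obj K; B \<in> Obj K\<rbrakk> \<Longrightarrow> Proj1 K A B \<in> hom K (Prod K A B) A"
    and proj2_hom: "\<lbrakk>A \<in> Obj K; B \<in> Obj K\<rbrakk> \<Longrightarrow> Proj2 K A B \<in> hom K (Prod K A B) B"
    and prod_universal: "\<lbrakk>f \<in> hom K X A; g \<in> hom K X B\<rbrakk> \<Longrightarrow>
      \<exists>!h. h \<in> hom K X (Prod K A B) \<and> Proj1 K A B \<cdot> h = f \<and> Proj2 K A B \<cdot> h = g"

definition tuple :: "('o, 'a, 'z) cart_cat_scheme \<Rightarrow> 'a \<Rightarrow> 'a \<Rightarrow> 'a" where
  "tuple K f g = (THE h. h \<in> hom K (Dom K f) (Prod K (Cod K f) (Cod K g)) \<and>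
     Proj1 K (Cod K f) (Cod K g) \<cdot>\<^bsub>K\<^esub> h = f \<and> Proj2 K (Cod K f) (Cod K g) \<cdot>\<^bsub>K\<^esub> h = g)"

definition times_arr :: "('o, 'a, 'z) cart_cat_scheme \<Rightarrow> 'a \<Rightarrow> 'a \<Rightarrow> 'a" where
  "times_arr K f g =
     tuple K (f \<cdot>\<^bsub>K\<^esub> Proj1 K (Dom K f) (Dom K g)) (g \<cdot>\<^bsub>K\<^esub> Proj2 K (Dom K f) (Dom K g))"


section \<open>Tight limits\<close>

text \<open>
  The part of the data of a pseudo double category that tight limits refer to. Loose composition
  and its coherence cells do not occur in the definition of a tight limit and are left out.
  The set \<open>cells M p q f g\<close> consists of the cells from \<open>p\<close> to \<open>q\<close> with left side \<open>f\<close>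
  and right side \<open>g\<close>; \<open>vcomp M y x\<close> is \<open>x\<close> followed by \<open>y\<close>.
\<close>

record ('o, 'a, 'l, 'c) double_cat =
  tight :: "('o, 'a) cat"
  loose :: "'o \<Rightarrow> 'o \<Rightarrow> 'l set"
  cells :: "'l \<Rightarrow> 'l \<Rightarrow> 'a \<Rightarrow> 'a \<Rightarrow> 'c set"
  vcomp :: "'c \<Rightarrow> 'c \<Rightarrow> 'c"
  loose_id :: "'o \<Rightarrow> 'l"
  id_cell :: "'a \<Rightarrow> 'c"

definition is_tight_terminal :: "('o, 'a, 'l, 'c) double_cat \<Rightarrow> 'o \<Rightarrow> bool" where
  "is_tight_terminal M T \<longleftrightarrow>
     is_terminal (tight M) T \<and>
     (\<forall>A\<in>Obj (tight M). \<forall>B\<in>Obj (tight M). \<forall>p\<in>loose M A B.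
        \<forall>f\<in>hom (tight M) A T. \<forall>g\<in>hom (tight M) B T.
          \<exists>!x. x \<in> cells M p (loose_id M T) f g)"

definition has_tight_terminal :: "('o, 'a, 'l, 'c) double_cat \<Rightarrow> bool" where
  "has_tight_terminal M \<longleftrightarrow> (\<exists>T. is_tight_terminal M T)"

definition is_tight_limit ::
  "('j, 'k, 'y) cat_scheme \<Rightarrow> ('o, 'a, 'l, 'c) double_cat \<Rightarrow> ('j, 'k, 'o, 'a) diagram
    \<Rightarrow> 'o \<Rightarrow> ('j \<Rightarrow> 'a) \<Rightarrow> bool" where
  "is_tight_limit J M D L p \<longleftrightarrow>
     is_limit J (tight M) D L p \<and>
     (\<forall>U\<in>Obj (tight M). \<forall>V\<in>Obj (tight M). \<forall>u\<in>loose M U V. \<forall>a a' \<xi>.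
        is_cone J (tight M) D U a \<longrightarrow>
        is_cone J (tight M) D V a' \<longrightarrow>
        (\<forall>j\<in>Obj J. \<xi> j \<in> cells M u (loose_id M (obj_map D j)) (a j) (a' j)) \<longrightarrow>
        (\<forall>k\<in>Arr J. vcomp M (id_cell M (arr_map D k)) (\<xi> (Dom J k)) = \<xi> (Cod J k)) \<longrightarrow>
        (\<forall>h h'. is_induced J (tight M) L p U a h \<longrightarrow>
                is_induced J (tight M) L p V a' h' \<longrightarrow>
                (\<exists>!x. x \<in> cells M u (loose_id M L) h h' \<and>
                     (\<forall>j\<in>Obj J. vcomp M (id_cell M (p j)) x = \<xi> j))))"

definition has_tight_limits ::
  "('j, 'k, 'y) cat_scheme \<Rightarrow> ('o, 'a, 'l, 'c) double_cat \<Rightarrow> bool" where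
  "has_tight_limits J M \<longleftrightarrow>
     (\<forall>D. is_functor J (tight M) D \<longrightarrow> (\<exists>L p. is_tight_limit J M D L p))"


section \<open>Mealy machines\<close>

definition mly_loose ::
  "('o, 'a, 'z) cart_cat_scheme \<Rightarrow> 'o \<Rightarrow> 'o \<Rightarrow> ('o \<times> 'a \<times> 'a) set" where
  "mly_loose K A B = {(E, d, s). A \<in> Obj K \<and> B \<in> Obj K \<and> E \<in> Obj K \<and>
     d \<in> hom K (Prod K A E) E \<and> s \<in> hom K (Prod K A E) B}"

definition mly_cells :: "('o, 'a, 'z) cart_cat_scheme
    \<Rightarrow> 'o \<times> 'a \<times> 'a \<Rightarrow> 'o \<times> 'a \<times> 'a \<Rightarrow> 'a \<Rightarrow> 'a \<Rightarrow> 'a set" where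
  "mly_cells K = (\<lambda>(E, d, s) (E', d', s') f g. {\<alpha> \<in> hom K E E'.
     f \<in> Arr K \<and> g \<in> Arr K \<and>
     (E, d, s) \<in> mly_loose K (Dom K f) (Dom K g) \<and>
     (E', d', s') \<in> mly_loose K (Cod K f) (Cod K g) \<and>
     \<alpha> \<cdot>\<^bsub>K\<^esub> d = d' \<cdot>\<^bsub>K\<^esub> times_arr K f \<alpha> \<and>
     g \<cdot>\<^bsub>K\<^esub> s = s' \<cdot>\<^bsub>K\<^esub> times_arr K f \<alpha>})"

text \<open>
  The transition map \<open>A \<times> 1 \<rightarrow> 1\<close> of the loose identity is the only morphism of that type,
  here written as the second projection.
\<close>

definition Mly ::
  "('o, 'a, 'z) cart_cat_scheme \<Rightarrow> ('o, 'a, 'o \<times> 'a \<times> 'a, 'a) double_cat" where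
  "Mly K =
    \<lparr>tight = cat.truncate K,
     loose = mly_loose K,
     cells = mly_cells K,
     vcomp = Comp K,
     loose_id = (\<lambda>A. (One K, Proj2 K A (One K), Proj1 K A (One K))),
     id_cell = (\<lambda>f. Ident K (One K))\<rparr>"

context cartesian_category
begin

lemma one_obj: "One K \<in> Obj K"
  using one_terminal by (simp add: is_terminal_def)

lemma hom_obj: "f \<in> hom K A B \<Longrightarrow> A \<in> Obj K \<and> B \<in> Obj K"
  using dom_obj cod_obj by (auto simp: hom_def)

lemma tuple_props:
  assumes "f \<in> hom K X A" "g \<in> hom K X B"
  shows "tuple K f g \<in> hom K X (Prod K A B) \<and>
    Proj1 K A B \<cdot> tuple K f g = f \<and> Proj2 K A B \<cdot> tuple K f g = g"
proof -
  have "Dom K f = X" "Cod K f = A" "Cod K g = B"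
    using assms by (auto simp: hom_def)
  then show ?thesis
    using theI'[OF prod_universal[OF assms]] by (simp add: tuple_def)
qed

lemma times_props:
  assumes f: "f \<in> hom K A X" and g: "g \<in> hom K B Y"
  shows "times_arr K f g \<in> hom K (Prod K A B) (Prod K X Y)"
    and "Proj1 K X Y \<cdot> times_arr K f g = f \<cdot> Proj1 K A B"
    and "Proj2 K X Y \<cdot> times_arr K f g = g \<cdot> Proj2 K A B"
proof -
  have o: "A \<in> Obj K" "B \<in> Obj K" using hom_obj f g by auto
  have eq: "times_arr K f g = tuple K (f \<cdot> Proj1 K A B) (g \<cdot> Proj2 K A B)"
    using f g by (simp add: times_arr_def hom_def)
  note t = tuple_props[OF comp_hom[OF proj1_hom[OF o] f] comp_hom[OF proj2_hom[OF o] g]]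
  show "times_arr K f g \<in> hom K (Prod K A B) (Prod K X Y)"
    and "Proj1 K X Y \<cdot> times_arr K f g = f \<cdot> Proj1 K A B"
    and "Proj2 K X Y \<cdot> times_arr K f g = g \<cdot> Proj2 K A B"
    unfolding eq using t by auto
qed

lemma times_comp:
  assumes f: "f \<in> hom K A X" and g: "g \<in> hom K B Y"
    and f': "f' \<in> hom K X X'" and g': "g' \<in> hom K Y Y'"
  shows "times_arr K (f' \<cdot> f) (g' \<cdot> g) = times_arr K f' g' \<cdot> times_arr K f g"
proof -
  have o: "A \<in> Obj K" "B \<in> Obj K" "X \<in> Obj K" "Y \<in> Obj K" "X' \<in> Obj K" "Y' \<in> Obj K"
    using hom_obj f g f' g' by auto
  note ff = comp_hom[OF f f'] and gg = comp_hom[OF g g']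
  note T = times_props[OF f g] and T' = times_props[OF f' g'] and TT = times_props[OF ff gg]
  note pr = proj1_hom[OF o(1,2)] proj2_hom[OF o(1,2)] proj1_hom[OF o(3,4)] proj2_hom[OF o(3,4)]
    proj1_hom[OF o(5,6)] proj2_hom[OF o(5,6)]
  have c: "times_arr K f' g' \<cdot> times_arr K f g \<in> hom K (Prod K A B) (Prod K X' Y')"
    using T(1) T'(1) by (rule comp_hom)
  have 1: "Proj1 K X' Y' \<cdot> (times_arr K f' g' \<cdot> times_arr K f g) = (f' \<cdot> f) \<cdot> Proj1 K A B"
    using comp_assoc[OF T(1) T'(1) pr(5)] comp_assoc[OF T(1) pr(3) f'] comp_assoc[OF pr(1) f f'] T T'
    by simp
  have 2: "Proj2 K X' Y' \<cdot> (times_arr K f' g' \<cdot> times_arr K f g) = (g' \<cdot> g) \<cdot> Proj2 K A B"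
    using comp_assoc[OF T(1) T'(1) pr(6)] comp_assoc[OF T(1) pr(4) g'] comp_assoc[OF pr(2) g g'] T T'
    by simp
  from prod_universal[OF comp_hom[OF pr(1) ff] comp_hom[OF pr(2) gg]] TT c 1 2
  show ?thesis by blast
qed

lemma mly_loose_id: "A \<in> Obj K \<Longrightarrow> loose_id (Mly K) A \<in> loose (Mly K) A A"
  using one_obj proj1_hom proj2_hom by (simp add: Mly_def mly_loose_def)

lemma mly_id_cell:
  assumes f: "f \<in> hom K A B"
  shows "id_cell (Mly K) f \<in> cells (Mly K) (loose_id (Mly K) A) (loose_id (Mly K) B) f f"
proof -
  have o: "A \<in> Obj K" "B \<in> Obj K" using hom_obj f by auto
  note i = ident_hom[OF one_obj]
  have "Ident K (One K) \<cdot> Proj2 K A (One K) = Proj2 K A (One K)"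
    using ident_left[OF proj2_hom[OF o(1) one_obj]] .
  then show ?thesis
    using times_props[OF f i] i f mly_loose_id[OF o(1)] mly_loose_id[OF o(2)]
    by (simp add: Mly_def mly_cells_def hom_def)
qed

lemma mly_vcomp:
  assumes x: "x \<in> cells (Mly K) p q f g" and y: "y \<in> cells (Mly K) q r f' g'"
    and fc: "Cod K f = Dom K f'" and gc: "Cod K g = Dom K g'"
  shows "vcomp (Mly K) y x \<in> cells (Mly K) p r (f' \<cdot> f) (g' \<cdot> g)"
proof -
  obtain E d s where p: "p = (E, d, s)" by (cases p)
  obtain E' d' s' where q: "q = (E', d', s')" by (cases q)
  obtain E'' d'' s'' where r: "r = (E'', d'', s'')" by (cases r)
  define A B X Y X' Y' where defs: "A = Dom K f" "B = Dom K g" "X = Cod K f" "Y = Cod K g"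
    "X' = Cod K f'" "Y' = Cod K g'"
  have h: "f \<in> hom K A X" "g \<in> hom K B Y" "f' \<in> hom K X X'" "g' \<in> hom K Y Y'"
    "x \<in> hom K E E'" "y \<in> hom K E' E''"
    using x y fc gc unfolding p q r defs by (auto simp: Mly_def mly_cells_def hom_def)
  have l: "(E, d, s) \<in> mly_loose K A B" "(E', d', s') \<in> mly_loose K X Y"
    "(E'', d'', s'') \<in> mly_loose K X' Y'"
    using x y unfolding p q r defs by (auto simp: Mly_def mly_cells_def)
  have e: "x \<cdot> d = d' \<cdot> times_arr K f x" "g \<cdot> s = s' \<cdot> times_arr K f x"
    "y \<cdot> d' = d'' \<cdot> times_arr K f' y" "g' \<cdot> s' = s'' \<cdot> times_arr K f' y"
    using x y unfolding p q r by (auto simp: Mly_def mly_cells_def)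
  have m: "d \<in> hom K (Prod K A E) E" "s \<in> hom K (Prod K A E) B"
    "d' \<in> hom K (Prod K X E') E'" "s' \<in> hom K (Prod K X E') Y"
    "d'' \<in> hom K (Prod K X' E'') E''" "s'' \<in> hom K (Prod K X' E'') Y'"
    using l by (auto simp: mly_loose_def)
  note t = times_props(1)[OF h(1) h(5)] and t' = times_props(1)[OF h(3) h(6)]
  have 1: "(y \<cdot> x) \<cdot> d = d'' \<cdot> times_arr K (f' \<cdot> f) (y \<cdot> x)"
    using comp_assoc[OF m(1) h(5) h(6)] comp_assoc[OF t m(3) h(6)] comp_assoc[OF t t' m(5)]
      times_comp[OF h(1) h(5) h(3) h(6)] e by simp
  have 2: "(g' \<cdot> g) \<cdot> s = s'' \<cdot> times_arr K (f' \<cdot> f) (y \<cdot> x)"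
    using comp_assoc[OF m(2) h(2) h(4)] comp_assoc[OF t m(4) h(4)] comp_assoc[OF t t' m(6)]
      times_comp[OF h(1) h(5) h(3) h(6)] e by simp
  have "f' \<cdot> f \<in> hom K A X'" "g' \<cdot> g \<in> hom K B Y'" "y \<cdot> x \<in> hom K E E''"
    using comp_hom h by blast+
  then show ?thesis
    using 1 2 l unfolding p r by (simp add: Mly_def mly_cells_def hom_def)
qed

end

end

theory Submission
  imports Defs
begin

text \<open>
  The loose identities have a terminal carrier, so a cell \<open>u \<Rightarrow> \<iota>\<^sub>L\<close> from \<open>u = (E, d, s)\<close> with
  sides \<open>h\<close>, \<open>h'\<close> can only be the map \<open>E \<rightarrow> 1\<close>, and it exists iff \<open>h' \<circ> s = h \<circ> \<pi>\<^sub>1\<close>. This equation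
  can be checked after composing with the projections of a limit cone \<open>p\<close>, where it says that
  there are cells \<open>u \<Rightarrow> \<iota>\<^bsub>D j\<^esub>\<close> with sides \<open>p j \<circ> h\<close> and \<open>p j \<circ> h'\<close>. Hence every limit in \<open>K\<close>,
  of any shape, is a tight limit.
\<close>

text \<open>\<open>Mly K\<close> keeps only the bare category underlying \<open>K\<close> as its
  tight part, forgetting the chosen products. These rewrites bring statements about
  \<open>tight (Mly K)\<close> back to \<open>K\<close>.\<close>

lemma cat_truncate_simps [simp]:
  "Obj (cat.truncate C) = Obj C" "Arr (cat.truncate C) = Arr C"
  "Dom (cat.truncate C) = Dom C" "Cod (cat.truncate C) = Cod C"
  "Ident (cat.truncate C) = Ident C" "Comp (cat.truncate C) = Comp C"
  "hom (cat.truncate C) = hom C"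
  by (simp_all add: cat.truncate_def hom_def fun_eq_iff)

lemma tight_Mly [simp]: "tight (Mly K) = cat.truncate K"
  by (simp add: Mly_def)

lemma limit_truncate [simp]:
  "is_functor J (cat.truncate C) = is_functor J C"
  "is_cone J (cat.truncate C) = is_cone J C"
  "is_induced J (cat.truncate C) = is_induced J C"
  "is_limit J (cat.truncate C) = is_limit J C"
  "is_terminal (cat.truncate C) = is_terminal C"
  by (simp_all add: fun_eq_iff is_functor_def is_cone_def is_induced_def is_limit_def
      is_terminal_def)

text \<open>The composites \<open>p j \<cdot> f\<close> form a cone on \<open>X\<close> that both
  \<open>f\<close> and \<open>g\<close> induce, so the uniqueness half of the limit property
  identifies them.\<close>

lemma (in category) limit_jointly_monic:
  assumes J: "category J" and D: "is_functor J C D" and L: "is_limit J C D L p"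
    and f: "f \<in> hom C X L" and g: "g \<in> hom C X L"
    and eq: "\<And>j. j \<in> Obj J \<Longrightarrow> p j \<cdot> f = p j \<cdot> g"
  shows "f = g"
proof -
  have cone: "is_cone J C D L p"
    using L by (simp add: is_limit_def)
  then have p: "p j \<in> hom C L (obj_map D j)" if "j \<in> Obj J" for j
    using that by (simp add: is_cone_def)
  have "is_cone J C D X (\<lambda>j. p j \<cdot> f)"
    unfolding is_cone_def
  proof (intro conjI ballI)
    show "X \<in> Obj C"
      using f dom_obj by (auto simp: hom_def)
    show "p j \<cdot> f \<in> hom C X (obj_map D j)" if "j \<in> Obj J" for j
      using comp_hom[OF f p[OF that]] .
    fix k assume k: "k \<in> Arr J"
    have "arr_map D k \<in> hom C (obj_map D (Dom J k)) (obj_map D (Cod J k))"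
      using D k by (simp add: is_functor_def)
    then have "arr_map D k \<cdot> (p (Dom J k) \<cdot> f) = (arr_map D k \<cdot> p (Dom J k)) \<cdot> f"
      \<comment> \<open>The legs \<open>p\<close> are typed only at objects of \<open>J\<close>;
        that \<open>J\<close> is a category puts \<open>Dom J k\<close> among them.\<close>
      using comp_assoc[OF f p[OF category.dom_obj[OF J k]]] by simp
    then show "arr_map D k \<cdot> (p (Dom J k) \<cdot> f) = p (Cod J k) \<cdot> f"
      using cone k by (simp add: is_cone_def)
  qed
  then have "\<exists>!h. is_induced J C L p X (\<lambda>j. p j \<cdot> f) h"
    using L by (simp add: is_limit_def)
  then show ?thesis
    using f g eq unfolding is_induced_def by metis
qed

context cartesian_category
begin

lemma hom_One_eq: "f \<in> hom K X (One K) \<Longrightarrow> g \<in> hom K X (One K) \<Longrightarrow> f = g"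
  using one_terminal hom_obj unfolding is_terminal_def by metis

lemma ex_hom_One: "X \<in> Obj K \<Longrightarrow> \<exists>f. f \<in> hom K X (One K)"
  using one_terminal unfolding is_terminal_def by metis

text \<open>The transition equation compares two maps into \<open>One K\<close>, so it always holds.
  In the output equation, \<open>Proj1 \<cdot> times_arr K h x\<close> is
  \<open>h \<cdot> Proj1\<close>, which makes \<open>x\<close> disappear.\<close>

lemma cells_loose_id_iff:
  assumes u: "(E, d, s) \<in> mly_loose K U V" and h: "h \<in> hom K U L" and h': "h' \<in> hom K V L"
  shows "x \<in> cells (Mly K) (E, d, s) (loose_id (Mly K) L) h h' \<longleftrightarrow>
    x \<in> hom K E (One K) \<and> h' \<cdot> s = h \<cdot> Proj1 K U E"
proof (cases "x \<in> hom K E (One K)")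
  case True
  have L: "L \<in> Obj K"
    using hom_obj[OF h] by simp
  have d: "d \<in> hom K (Prod K U E) E"
    using u by (simp add: mly_loose_def)
  note t = times_props[OF h True]
  have "x \<cdot> d = Proj2 K L (One K) \<cdot> times_arr K h x"
    using hom_One_eq[OF comp_hom[OF d True] comp_hom[OF t(1) proj2_hom[OF L one_obj]]] .
  moreover have "(One K, Proj2 K L (One K), Proj1 K L (One K)) \<in> mly_loose K L L"
    using mly_loose_id[OF L] by (simp add: Mly_def)
  ultimately show ?thesis
    using True u h h' t(2) by (simp add: Mly_def mly_cells_def hom_def)
next
  case False
  then show ?thesis
    by (simp add: Mly_def mly_cells_def)
qed

text \<open>The equation does not mention \<open>x\<close>, so existence and uniqueness are those of
  the map from \<open>E\<close> to \<open>One K\<close>.\<close>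

lemma ex1_cell_loose_id:
  assumes u: "(E, d, s) \<in> mly_loose K U V" and h: "h \<in> hom K U L" and h': "h' \<in> hom K V L"
    and eq: "h' \<cdot> s = h \<cdot> Proj1 K U E"
  shows "\<exists>!x. x \<in> cells (Mly K) (E, d, s) (loose_id (Mly K) L) h h'"
proof -
  have "E \<in> Obj K"
    using u by (simp add: mly_loose_def)
  then show ?thesis
    unfolding cells_loose_id_iff[OF u h h'] using ex_hom_One hom_One_eq eq by blast
qed

lemma tight_terminal:
  assumes T: "is_terminal K T"
  shows "is_tight_terminal (Mly K) T"
  unfolding is_tight_terminal_def
proof (intro conjI ballI)
  show "is_terminal (tight (Mly K)) T"
    using T by simp
next
  fix A B u f g
  assume u: "u \<in> loose (Mly K) A B"
    and "f \<in> hom (tight (Mly K)) A T" "g \<in> hom (tight (Mly K)) B T"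
  then have f: "f \<in> hom K A T" and g: "g \<in> hom K B T"
    by simp_all
  obtain E d s where u_eq: "u = (E, d, s)"
    by (cases u)
  have u': "(E, d, s) \<in> mly_loose K A B"
    using u u_eq by (simp add: Mly_def)
  then have o: "A \<in> Obj K" "E \<in> Obj K" and s: "s \<in> hom K (Prod K A E) B"
    by (simp_all add: mly_loose_def)
  \<comment> \<open>Both sides are maps from \<open>Prod K A E\<close> to the terminal object
    \<open>T\<close>.\<close>
  have "g \<cdot> s = f \<cdot> Proj1 K A E"
    using T prod_obj[OF o] comp_hom[OF s g] comp_hom[OF proj1_hom[OF o] f]
    unfolding is_terminal_def by metis
  then show "\<exists>!x. x \<in> cells (Mly K) u (loose_id (Mly K) T) f g"
    unfolding u_eq by (rule ex1_cell_loose_id[OF u' f g])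
qed

lemma tight_limit:
  assumes J: "category J" and D: "is_functor J K D" and L: "is_limit J K D L p"
  shows "is_tight_limit J (Mly K) D L p"
  unfolding is_tight_limit_def
proof (intro conjI ballI allI impI)
  show "is_limit J (tight (Mly K)) D L p"
    using L by simp
next
  fix U V u a a' \<xi> h h'
  assume u: "u \<in> loose (Mly K) U V"
    and "is_cone J (tight (Mly K)) D U a" "is_cone J (tight (Mly K)) D V a'"
    and \<xi>: "\<forall>j\<in>Obj J. \<xi> j \<in> cells (Mly K) u (loose_id (Mly K) (obj_map D j)) (a j) (a' j)"
    and "is_induced J (tight (Mly K)) L p U a h" "is_induced J (tight (Mly K)) L p V a' h'"
  then have h: "h \<in> hom K U L" and h': "h' \<in> hom K V L"
    and a: "\<And>j. j \<in> Obj J \<Longrightarrow> a j \<in> hom K U (obj_map D j)"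
    and a': "\<And>j. j \<in> Obj J \<Longrightarrow> a' j \<in> hom K V (obj_map D j)"
    and ph: "\<And>j. j \<in> Obj J \<Longrightarrow> p j \<cdot> h = a j"
    and ph': "\<And>j. j \<in> Obj J \<Longrightarrow> p j \<cdot> h' = a' j"
    by (simp_all add: is_cone_def is_induced_def)
  have p: "p j \<in> hom K L (obj_map D j)" if "j \<in> Obj J" for j
    using L that by (simp add: is_limit_def is_cone_def)
  obtain E d s where u_eq: "u = (E, d, s)"
    by (cases u)
  have u': "(E, d, s) \<in> mly_loose K U V"
    using u u_eq by (simp add: Mly_def)
  then have o: "U \<in> Obj K" "E \<in> Obj K" and s: "s \<in> hom K (Prod K U E) V"
    by (simp_all add: mly_loose_def)
  note pr = proj1_hom[OF o]
  \<comment> \<open>Here the characterization of cells is read backwards: the given cell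
    \<open>\<xi> j\<close> yields the output equation at \<open>j\<close>.\<close>
  have \<xi>': "\<xi> j \<in> hom K E (One K)" "a' j \<cdot> s = a j \<cdot> Proj1 K U E" if "j \<in> Obj J" for j
    using \<xi> that cells_loose_id_iff[OF u' a[OF that] a'[OF that]] unfolding u_eq by blast+
  \<comment> \<open>Reassociating and using \<open>ph\<close>, \<open>ph'\<close> turns this into
    the output equation of \<open>\<xi> j\<close>.\<close>
  have "p j \<cdot> (h' \<cdot> s) = p j \<cdot> (h \<cdot> Proj1 K U E)" if "j \<in> Obj J" for j
    using comp_assoc[OF s h' p[OF that]] comp_assoc[OF pr h p[OF that]] \<xi>'(2) ph ph' that by simp
  then have "h' \<cdot> s = h \<cdot> Proj1 K U E"
    by (rule limit_jointly_monic[OF J D L comp_hom[OF s h'] comp_hom[OF pr h]])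
  then have "\<exists>!x. x \<in> cells (Mly K) u (loose_id (Mly K) L) h h'"
    unfolding u_eq by (rule ex1_cell_loose_id[OF u' h h'])
  \<comment> \<open>Compatibility with the family \<open>\<xi>\<close> is automatic, since both
    sides are maps from \<open>E\<close> to \<open>One K\<close>. The unique cell therefore also
    satisfies the extra condition.\<close>
  moreover have "vcomp (Mly K) (id_cell (Mly K) (p j)) x = \<xi> j"
    if "x \<in> cells (Mly K) u (loose_id (Mly K) L) h h'" "j \<in> Obj J" for x j
  proof -
    have x: "x \<in> hom K E (One K)"
      using that(1) cells_loose_id_iff[OF u' h h'] unfolding u_eq by blast
    show ?thesis
      using ident_left[OF x] hom_One_eq[OF x \<xi>'(1)[OF that(2)]] by (simp add: Mly_def)
  qed
  ultimately show "\<exists>!x. x \<in> cells (Mly K) u (loose_id (Mly K) L) h h' \<and>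
      (\<forall>j\<in>Obj J. vcomp (Mly K) (id_cell (Mly K) (p j)) x = \<xi> j)"
    by blast
qed

lemma has_tight_limits:
  "category J \<Longrightarrow> has_limits J K \<Longrightarrow> has_tight_limits J (Mly K)"
  unfolding has_limits_def has_tight_limits_def by (simp, blast intro: tight_limit)

lemma has_tight_terminal: "has_terminal K \<Longrightarrow> has_tight_terminal (Mly K)"
  unfolding has_terminal_def has_tight_terminal_def using tight_terminal by blast

end

theorem theorem30:
  fixes K :: "('o, 'a, 'z) cart_cat_scheme"
  assumes "cartesian_category K"
  shows
    "(has_terminal K \<and> has_limits cospan K \<longrightarrow>
        has_tight_terminal (Mly K) \<and> has_tight_limits cospan (Mly K)) \<and>
     ((\<forall>I :: 'i set. has_limits (wide_cospan I) K) \<longrightarrow>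
        (\<forall>I :: 'i set. has_tight_limits (wide_cospan I) (Mly K))) \<and>
     ((\<forall>I :: 'i set. has_limits (discrete I) K) \<and> has_limits parallel_pair K \<longrightarrow>
        (\<forall>I :: 'i set. has_tight_limits (discrete I) (Mly K)) \<and>
        has_tight_limits parallel_pair (Mly K))"
proof -
  interpret cartesian_category K
    by (rule assms)
  \<comment> \<open>Every shape named here is a category, so the limit claims are instances of one
    result for arbitrary \<open>J\<close>.\<close>
  show ?thesis
    by (simp add: has_tight_terminal has_tight_limits category_discrete category_wide_cospan
        category_cospan category_parallel_pair)
qed

end
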